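(* Let $H=(V,E,w)$ be a connected weighted hypergraph and let $s\in\mathbb R^V$ with $\mathbf 1^\top s=0$. Let $\mu\in\mathcal M(s)$, set $r_e:=\mu_e/w_e$ for $e\in E$, and let $\mu^\star$ be any minimizer of $q$ over $\mathcal M(s)$. Let $\bar\mu$ be any minimizer of $\nu\mapsto\sum_{e\in E}r_e\nu_e$ over $\mathcal M(s)$, and define $\delta:=q(\mu)-q(\mu^\star)$. Then $$0\le 2q(\mu)-L_s(r)=\sum_{e\in E}r_e(\mu_e-\bar\mu_e)\le\delta+\sqrt{2\delta}\,\|\mu-\bar\mu\|_{w^{-1}}.$$ If $x_r\in\mathcal X_0$ is any maximizer of the problem defining $L_s(r)$, then $$\mathcal P(x_r)-\mathrm{OPT}\le\sqrt{2\delta}\,\|\mu-\bar\mu\|_{w^{-1}}.$$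
   Context: A weighted hypergraph $H=(V,E,w)$ has a finite vertex set $V$, a finite nonempty family $E$ of nonempty subsets of $V$ (hyperedges), and weights $w_e>0$. It is connected if any two vertices $u,v$ are joined by a sequence $u=p_0,\dots,p_k=v$ of vertices and hyperedges $e_1,\dots,e_k$ with $p_{i-1},p_i\in e_i$. $R_e(x):=\max_{u\in e}x_u-\min_{v\in e}x_v$; $d_v:=\sum_{e\ni v}w_e$; $D:=\mathrm{diag}(d_v)$; $\mathcal X_0:=\{x\in\mathbb R^V:\langle Dx,\mathbf 1\rangle=0\}$; $\mathcal P(x):=\frac12\sum_ew_eR_e(x)^2-\langle s,x\rangle$; $\mathrm{OPT}:=\min_{x\in\mathcal X_0}\mathcal P(x)$. For $z\in\mathbb R^E$: $\|z\|_{w^{-1}}^2:=\sum_ez_e^2/w_e$ and $q(z):=\frac12\|z\|_{w^{-1}}^2$. $\mathcal M(s)$ is the set of $\mu\in\mathbb R^E_{\ge0}$ for which there are $p_{ev},n_{ev}\ge0$ ($e\in E$, $v\in e$) with $\sum_{e\ni v}(p_{ev}-n_{ev})=s_v$ for all $v\in V$ and $\sum_{v\in e}p_{ev}=\sum_{v\in e}n_{ev}=\mu_e$ for all $e\in E$. For $r\in\mathbb R^E_{\ge0}$, $L_s(r):=\max\{\langle s,x\rangle:\ x\in\mathcal X_0,\ R_e(x)\le r_e\ \forall e\in E\}$. *)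

theory Defs
  imports "HOL-Analysis.Analysis"
begin

text \<open>
  The vertex set is the finite type \<open>'v\<close>. The family of hyperedges is indexed by the finite
  type \<open>'e\<close>: \<open>edge e\<close> is the vertex set of the hyperedge \<open>e\<close>, so parallel hyperedges are
  allowed. Finiteness of both sets and nonemptiness of the family hold because types of class
  \<open>finite\<close> are finite and types are nonempty.
\<close>

definition weighted_hypergraph :: "('e::finite \<Rightarrow> 'v::finite set) \<Rightarrow> real ^ 'e \<Rightarrow> bool" where
  "weighted_hypergraph edge w \<longleftrightarrow> (\<forall>e. edge e \<noteq> {}) \<and> (\<forall>e. w $ e > 0)"

definition hypergraph_connected :: "('e::finite \<Rightarrow> 'v::finite set) \<Rightarrow> bool" where
  "hypergraph_connected edge \<longleftrightarrow>
    (\<forall>u v. \<exists>(k::nat) (p :: nat \<Rightarrow> 'v) (f :: nat \<Rightarrow> 'e).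
       p 0 = u \<and> p k = v \<and>
       (\<forall>i\<in>{1..k}. p (i - 1) \<in> edge (f i) \<and> p i \<in> edge (f i)))"

definition edge_range :: "('e::finite \<Rightarrow> 'v::finite set) \<Rightarrow> 'e \<Rightarrow> real ^ 'v \<Rightarrow> real" where
  "edge_range edge e x = (MAX u\<in>edge e. x $ u) - (MIN v\<in>edge e. x $ v)"

definition degree :: "('e::finite \<Rightarrow> 'v::finite set) \<Rightarrow> real ^ 'e \<Rightarrow> 'v \<Rightarrow> real" where
  "degree edge w v = (\<Sum>e | v \<in> edge e. w $ e)"

definition degree_matrix ::
    "('e::finite \<Rightarrow> 'v::finite set) \<Rightarrow> real ^ 'e \<Rightarrow> real ^ 'v ^ 'v" where
  "degree_matrix edge w = (\<chi> u v. if u = v then degree edge w v else 0)"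

text \<open>In \<open>real ^ 'v\<close>, the constant \<open>1\<close> is the all-ones vector.\<close>

definition centered_space ::
    "('e::finite \<Rightarrow> 'v::finite set) \<Rightarrow> real ^ 'e \<Rightarrow> (real ^ 'v) set" where
  "centered_space edge w = {x. (degree_matrix edge w *v x) \<bullet> 1 = 0}"

definition primal_obj ::
    "('e::finite \<Rightarrow> 'v::finite set) \<Rightarrow> real ^ 'e \<Rightarrow> real ^ 'v \<Rightarrow> real ^ 'v \<Rightarrow> real" where
  "primal_obj edge w s x = 1 / 2 * (\<Sum>e\<in>UNIV. w $ e * (edge_range edge e x)\<^sup>2) - s \<bullet> x"

text \<open>
  \<open>LEAST\<close> and \<open>GREATEST\<close> over the set of attained values denote a true minimum and a true
  maximum: their value is unspecified if the infimum or supremum is not attained.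
\<close>

definition primal_opt ::
    "('e::finite \<Rightarrow> 'v::finite set) \<Rightarrow> real ^ 'e \<Rightarrow> real ^ 'v \<Rightarrow> real" where
  "primal_opt edge w s = (LEAST t. t \<in> primal_obj edge w s ` centered_space edge w)"

definition inv_weight_norm :: "real ^ 'e::finite \<Rightarrow> real ^ 'e \<Rightarrow> real" where
  "inv_weight_norm w z = sqrt (\<Sum>e\<in>UNIV. (z $ e)\<^sup>2 / w $ e)"

definition dual_obj :: "real ^ 'e::finite \<Rightarrow> real ^ 'e \<Rightarrow> real" where
  "dual_obj w z = 1 / 2 * (inv_weight_norm w z)\<^sup>2"

text \<open>
  \<open>p\<close> and \<open>n\<close> are total functions, but only their values at incident pairs \<open>v \<in> edge e\<close>
  are constrained and used.
\<close>

definition dual_feasible ::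
    "('e::finite \<Rightarrow> 'v::finite set) \<Rightarrow> real ^ 'v \<Rightarrow> (real ^ 'e) set" where
  "dual_feasible edge s =
    {\<mu>. (\<forall>e. \<mu> $ e \<ge> 0) \<and>
        (\<exists>p n :: 'e \<Rightarrow> 'v \<Rightarrow> real.
           (\<forall>e. \<forall>v\<in>edge e. p e v \<ge> 0 \<and> n e v \<ge> 0) \<and>
           (\<forall>v. (\<Sum>e | v \<in> edge e. p e v - n e v) = s $ v) \<and>
           (\<forall>e. (\<Sum>v\<in>edge e. p e v) = \<mu> $ e \<and> (\<Sum>v\<in>edge e. n e v) = \<mu> $ e))}"

definition range_feasible ::
    "('e::finite \<Rightarrow> 'v::finite set) \<Rightarrow> real ^ 'e \<Rightarrow> real ^ 'e \<Rightarrow> (real ^ 'v) set" where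
  "range_feasible edge w r = {x \<in> centered_space edge w. \<forall>e. edge_range edge e x \<le> r $ e}"

definition range_value ::
    "('e::finite \<Rightarrow> 'v::finite set) \<Rightarrow> real ^ 'e \<Rightarrow> real ^ 'v \<Rightarrow> real ^ 'e \<Rightarrow> real" where
  "range_value edge w s r = (GREATEST t. t \<in> (\<lambda>x. s \<bullet> x) ` range_feasible edge w r)"

end

theory Submission
  imports Defs
begin

text \<open>
  Linear programming duality identifies \<open>L\<^sub>s(r)\<close> with the minimum of \<open>\<langle>r, \<nu>\<rangle>\<close> over \<open>\<M>(s)\<close>, so the
  gap \<open>2 q(\<mu>) - L\<^sub>s(r)\<close> is \<open>\<langle>r, \<mu> - \<mu>_bar\<rangle>\<close>, an inner product of \<open>\<mu>\<close> and \<open>\<mu> - \<mu>_bar\<close> in the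
  \<open>w\<^sup>-\<^sup>1\<close>-weighted space. There \<open>\<mu>_star\<close> is the point of least norm in the convex set \<open>\<M>(s)\<close>;
  its variational inequality and Cauchy-Schwarz bound the gap. The variational inequality also says that
  \<open>\<mu>_star\<close> minimises \<open>\<langle>\<mu>_star / w, \<nu>\<rangle>\<close>, and duality with \<open>r = \<mu>_star / w\<close> then
  produces a minimiser of \<open>\<P>\<close> with value \<open>- q(\<mu>_star)\<close>. As \<open>\<P>(x\<^sub>r) \<le> q(\<mu>) - L\<^sub>s(r)\<close>, the primal error is
  at most the gap minus \<open>\<delta>\<close>.
\<close>

section \<open>Points of least norm in a convex set\<close>

text \<open>If the angle at \<open>a\<close> between the directions to \<open>0\<close> and to
  \<open>b\<close> were acute, a short move from \<open>a\<close> towards \<open>b\<close> would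
  stay in \<open>K\<close> and come closer to the origin.\<close>

lemma min_norm_inner_ge:
  fixes a b :: "'a::real_inner"
  assumes "convex K" "a \<in> K" "b \<in> K" and min: "\<And>x. x \<in> K \<Longrightarrow> norm a \<le> norm x"
  shows "a \<bullet> a \<le> a \<bullet> b"
proof (rule ccontr)
  assume "\<not> a \<bullet> a \<le> a \<bullet> b"
  then have "(0 - a) \<bullet> (b - a) > 0"
    by (simp add: inner_diff_right)
  then obtain u where u: "0 < u" "u \<le> 1" "dist (a + u *\<^sub>R (b - a)) 0 < dist a 0"
    using closer_point_lemma by blast
  have "a + u *\<^sub>R (b - a) = (1 - u) *\<^sub>R a + u *\<^sub>R b"
    by (simp add: algebra_simps)
  also have "\<dots> \<in> K"
    using assms u by (intro convexD) auto
  finally show False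
    using min u(3) by fastforce
qed

text \<open>Write \<open>m = (m - a) + a\<close>. Cauchy-Schwarz handles the first part, as
  \<open>norm (m - a)\<close> is at most \<open>sqrt (2 * d)\<close>. The second part is at most
  \<open>a \<bullet> m - a \<bullet> a\<close>, hence at most \<open>d\<close>. Both estimates come
  from expanding \<open>2 * d\<close> around \<open>a\<close>.\<close>

lemma min_norm_gap:
  fixes a b m :: "'a::real_inner"
  assumes "convex K" "a \<in> K" "b \<in> K" "m \<in> K" and min: "\<And>x. x \<in> K \<Longrightarrow> norm a \<le> norm x"
    and d: "d = 1 / 2 * (norm m)\<^sup>2 - 1 / 2 * (norm a)\<^sup>2"
  shows "m \<bullet> (m - b) \<le> d + sqrt (2 * d) * norm (m - b)"
proof -
  have ab: "a \<bullet> a \<le> a \<bullet> b" and am: "a \<bullet> a \<le> a \<bullet> m"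
    using assms min_norm_inner_ge by blast+
  have d': "2 * d = (norm (m - a))\<^sup>2 + 2 * (a \<bullet> m - a \<bullet> a)"
    unfolding d by (simp add: power2_norm_eq_inner inner_diff inner_commute)
  then have "(norm (m - a))\<^sup>2 \<le> 2 * d"
    using am by simp
  then have "norm (m - a) \<le> sqrt (2 * d)"
    by (rule real_le_rsqrt)
  then have "(m - a) \<bullet> (m - b) \<le> sqrt (2 * d) * norm (m - b)"
    by (meson mult_right_mono norm_cauchy_schwarz norm_ge_zero order_trans)
  moreover have "a \<bullet> (m - b) \<le> d"
  proof -
    have "2 * (a \<bullet> m - a \<bullet> a) \<le> 2 * d"
      unfolding d' by simp
    then show ?thesis
      using ab by (simp add: inner_diff_right)
  qed
  ultimately show ?thesis
    by (simp add: inner_diff_left)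
qed

section \<open>The weighted norm as a Euclidean norm\<close>

text \<open>An isometry from the weighted norm to the Euclidean one, so that the facts on least-norm
  points apply verbatim.\<close>

definition rescale :: "real ^ 'e \<Rightarrow> real ^ 'e \<Rightarrow> real ^ 'e" where
  "rescale w z = (\<chi> e. z $ e / sqrt (w $ e))"

lemma linear_rescale: "linear (rescale w)"
  by (rule linearI) (simp_all add: rescale_def vec_eq_iff add_divide_distrib)

lemma inner_rescale:
  assumes "\<And>e. w $ e > 0"
  shows "rescale w y \<bullet> rescale w z = (\<chi> e. y $ e / w $ e) \<bullet> z"
  using assms by (simp add: rescale_def inner_vec_def less_imp_le)

lemma inv_weight_norm_eq:
  assumes "\<And>e. w $ e > 0"
  shows "inv_weight_norm w z = norm (rescale w z)"
  using assms
  by (simp add: inv_weight_norm_def norm_eq_sqrt_inner inner_rescale)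
    (simp add: inner_vec_def power2_eq_square)

lemma dual_obj_eq:
  assumes "\<And>e. w $ e > 0"
  shows "dual_obj w z = 1 / 2 * (norm (rescale w z))\<^sup>2"
  using assms by (simp add: dual_obj_def inv_weight_norm_eq)

lemma two_dual_obj_eq:
  assumes "\<And>e. w $ e > 0"
  shows "2 * dual_obj w z = (\<chi> e. z $ e / w $ e) \<bullet> z"
  using assms by (simp add: dual_obj_eq power2_norm_eq_inner inner_rescale)

section \<open>Hyperedge ranges\<close>

lemma edge_range_le_iff:
  fixes edge :: "'e::finite \<Rightarrow> 'v::finite set"
  assumes "edge e \<noteq> {}"
  shows "edge_range edge e x \<le> c \<longleftrightarrow> (\<forall>u\<in>edge e. \<forall>v\<in>edge e. x $ u - x $ v \<le> c)"
proof -
  have "edge_range edge e x \<le> c" if *: "\<And>u v. u \<in> edge e \<Longrightarrow> v \<in> edge e \<Longrightarrow> x $ u - x $ v \<le> c"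
  proof -
    obtain u where "u \<in> edge e" "(MAX u\<in>edge e. x $ u) = x $ u"
      using Max_in[of "(\<lambda>u. x $ u) ` edge e"] assms
      by (metis finite finite_imageI imageE image_is_empty)
    moreover obtain v where "v \<in> edge e" "(MIN u\<in>edge e. x $ u) = x $ v"
      using Min_in[of "(\<lambda>u. x $ u) ` edge e"] assms
      by (metis finite finite_imageI imageE image_is_empty)
    ultimately show ?thesis
      unfolding edge_range_def using * by simp
  qed
  moreover have "x $ u - x $ v \<le> edge_range edge e x" if "u \<in> edge e" "v \<in> edge e" for u v
    unfolding edge_range_def using that by (intro diff_mono Max_ge Min_le) auto
  ultimately show ?thesis
    by (meson order_trans)
qed

lemma edge_range_nonneg:
  fixes edge :: "'e::finite \<Rightarrow> 'v::finite set"
  assumes "edge e \<noteq> {}"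
  shows "0 \<le> edge_range edge e x"
  using edge_range_le_iff[of edge e x "edge_range edge e x"] assms by force

section \<open>The cone of pairs of a demand and a dual feasible vector\<close>

lemma dual_feasibleE:
  assumes "\<mu> \<in> dual_feasible edge s"
  obtains p n where "\<And>e v. v \<in> edge e \<Longrightarrow> 0 \<le> p e v" "\<And>e v. v \<in> edge e \<Longrightarrow> 0 \<le> n e v"
    and "\<And>v. (\<Sum>e | v \<in> edge e. p e v - n e v) = s $ v"
    and "\<And>e. (\<Sum>v\<in>edge e. p e v) = \<mu> $ e" "\<And>e. (\<Sum>v\<in>edge e. n e v) = \<mu> $ e"
  using assms unfolding dual_feasible_def by blast

lemma dual_feasibleI:
  assumes "\<And>e v. v \<in> edge e \<Longrightarrow> 0 \<le> p e v" "\<And>e v. v \<in> edge e \<Longrightarrow> 0 \<le> n e v"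
    and "\<And>v. (\<Sum>e | v \<in> edge e. p e v - n e v) = s $ v"
    and "\<And>e. (\<Sum>v\<in>edge e. p e v) = \<mu> $ e" "\<And>e. (\<Sum>v\<in>edge e. n e v) = \<mu> $ e"
  shows "\<mu> \<in> dual_feasible edge s"
proof -
  have "0 \<le> \<mu> $ e" for e
    using assms(1) by (auto simp flip: assms(4) intro: sum_nonneg)
  then show ?thesis
    unfolding dual_feasible_def using assms by blast
qed

lemma dual_feasible_nonneg: "\<mu> \<in> dual_feasible edge s \<Longrightarrow> 0 \<le> \<mu> $ e"
  by (simp add: dual_feasible_def)

lemma dual_feasible_zero: "0 \<in> dual_feasible edge 0"
  by (rule dual_feasibleI[of _ "\<lambda>_ _. 0" "\<lambda>_ _. 0"]) auto

text \<open>The demand varies along with the vector: strong duality combines solutions for different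
  demands, and convexity for a fixed demand is a special case.\<close>

lemma dual_feasible_add:
  assumes "\<mu> \<in> dual_feasible edge s" "\<nu> \<in> dual_feasible edge t"
  shows "\<mu> + \<nu> \<in> dual_feasible edge (s + t)"
proof -
  obtain p n where 1: "\<And>e v. v \<in> edge e \<Longrightarrow> 0 \<le> p e v" "\<And>e v. v \<in> edge e \<Longrightarrow> 0 \<le> n e v"
    "\<And>v. (\<Sum>e | v \<in> edge e. p e v - n e v) = s $ v"
    "\<And>e. (\<Sum>v\<in>edge e. p e v) = \<mu> $ e" "\<And>e. (\<Sum>v\<in>edge e. n e v) = \<mu> $ e"
    using assms(1) by (rule dual_feasibleE) blast
  obtain p' n' where 2: "\<And>e v. v \<in> edge e \<Longrightarrow> 0 \<le> p' e v" "\<And>e v. v \<in> edge e \<Longrightarrow> 0 \<le> n' e v"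
    "\<And>v. (\<Sum>e | v \<in> edge e. p' e v - n' e v) = t $ v"
    "\<And>e. (\<Sum>v\<in>edge e. p' e v) = \<nu> $ e" "\<And>e. (\<Sum>v\<in>edge e. n' e v) = \<nu> $ e"
    using assms(2) by (rule dual_feasibleE) blast
  show ?thesis
    by (rule dual_feasibleI[of _ "\<lambda>e v. p e v + p' e v" "\<lambda>e v. n e v + n' e v"])
      (simp_all add: 1 2 sum.distrib add_diff_add)
qed

lemma dual_feasible_scaleR:
  assumes "\<mu> \<in> dual_feasible edge s" "0 \<le> c"
  shows "c *\<^sub>R \<mu> \<in> dual_feasible edge (c *\<^sub>R s)"
proof -
  obtain p n where 1: "\<And>e v. v \<in> edge e \<Longrightarrow> 0 \<le> p e v" "\<And>e v. v \<in> edge e \<Longrightarrow> 0 \<le> n e v"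
    "\<And>v. (\<Sum>e | v \<in> edge e. p e v - n e v) = s $ v"
    "\<And>e. (\<Sum>v\<in>edge e. p e v) = \<mu> $ e" "\<And>e. (\<Sum>v\<in>edge e. n e v) = \<mu> $ e"
    using assms(1) by (rule dual_feasibleE) blast
  show ?thesis
    by (rule dual_feasibleI[of _ "\<lambda>e v. c * p e v" "\<lambda>e v. c * n e v"])
      (simp_all add: 1 assms(2) flip: sum_distrib_left right_diff_distrib)
qed

lemma convex_dual_feasible: "convex (dual_feasible edge s)"
proof (rule convexI)
  fix \<mu> \<nu> and a b :: real
  assume "\<mu> \<in> dual_feasible edge s" "\<nu> \<in> dual_feasible edge s" "0 \<le> a" "0 \<le> b" "a + b = 1"
  then have "a *\<^sub>R \<mu> + b *\<^sub>R \<nu> \<in> dual_feasible edge (a *\<^sub>R s + b *\<^sub>R s)"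
    by (intro dual_feasible_add dual_feasible_scaleR)
  then show "a *\<^sub>R \<mu> + b *\<^sub>R \<nu> \<in> dual_feasible edge s"
    using \<open>a + b = 1\<close> by (simp flip: scaleR_left_distrib)
qed

text \<open>One unit of flow through the hyperedge \<open>e\<close>, entering at \<open>u\<close>
  and leaving at \<open>v\<close>. These are the elementary solutions behind the generators in the
  Farkas argument.\<close>

lemma dual_feasible_axis:
  fixes edge :: "'e::finite \<Rightarrow> 'v::finite set"
  assumes "u \<in> edge e" "v \<in> edge e"
  shows "axis e 1 \<in> dual_feasible edge (axis u 1 - axis v 1)"
proof -
  have sel: "(\<Sum>e' | x \<in> edge e'. if e' = e \<and> x = y then 1 else 0) = (axis y 1 $ x :: real)"
    if "y \<in> edge e" for x y
    using that by (cases "x = y") (auto simp: axis_def sum.delta')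
  have tot: "(\<Sum>x\<in>edge e'. if e' = e \<and> x = y then 1 else 0) = (axis e 1 $ e' :: real)"
    if "y \<in> edge e" for e' y
    using that by (cases "e' = e") (auto simp: axis_def)
  show ?thesis
    by (rule dual_feasibleI[of _ "\<lambda>e' x. if e' = e \<and> x = u then 1 else 0"
          "\<lambda>e' x. if e' = e \<and> x = v then 1 else 0"])
      (simp_all add: assms sum_subtractf sel tot)
qed

section \<open>Linear programming duality\<close>

text \<open>Regroup the sum by hyperedges; inside \<open>e\<close>, replace \<open>x $ v\<close> by
  the maximum where it is weighted by \<open>p\<close> and by the minimum where it is weighted by
  \<open>n\<close>.\<close>

lemma weak_duality:
  fixes edge :: "'e::finite \<Rightarrow> 'v::finite set"
  assumes "\<nu> \<in> dual_feasible edge s"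
  shows "s \<bullet> x \<le> (\<Sum>e\<in>UNIV. \<nu> $ e * edge_range edge e x)"
proof -
  obtain p n where 1: "\<And>e v. v \<in> edge e \<Longrightarrow> 0 \<le> p e v" "\<And>e v. v \<in> edge e \<Longrightarrow> 0 \<le> n e v"
    "\<And>v. (\<Sum>e | v \<in> edge e. p e v - n e v) = s $ v"
    "\<And>e. (\<Sum>v\<in>edge e. p e v) = \<nu> $ e" "\<And>e. (\<Sum>v\<in>edge e. n e v) = \<nu> $ e"
    using assms by (rule dual_feasibleE) blast
  have "s \<bullet> x = (\<Sum>v\<in>UNIV. \<Sum>e | v \<in> edge e. (p e v - n e v) * x $ v)"
    by (simp add: inner_vec_def sum_distrib_right flip: 1(3))
  also have "\<dots> = (\<Sum>e\<in>UNIV. \<Sum>v\<in>edge e. (p e v - n e v) * x $ v)"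
    using sum.swap_restrict[of UNIV UNIV "\<lambda>v e. (p e v - n e v) * x $ v" "\<lambda>v e. v \<in> edge e"]
    by simp
  also have "\<dots> \<le> (\<Sum>e\<in>UNIV. \<nu> $ e * edge_range edge e x)"
  proof (rule sum_mono)
    fix e
    have "(\<Sum>v\<in>edge e. (p e v - n e v) * x $ v)
        \<le> (\<Sum>v\<in>edge e. p e v * (MAX u\<in>edge e. x $ u) - n e v * (MIN u\<in>edge e. x $ u))"
      unfolding left_diff_distrib
      using 1(1,2) by (intro sum_mono diff_mono mult_left_mono) auto
    also have "\<dots> = \<nu> $ e * edge_range edge e x"
      by (simp add: sum_subtractf edge_range_def right_diff_distrib 1 flip: sum_distrib_right)
    finally show "(\<Sum>v\<in>edge e. (p e v - n e v) * x $ v) \<le> \<nu> $ e * edge_range edge e x" .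
  qed
  finally show ?thesis .
qed

lemma weak_duality_range_feasible:
  fixes edge :: "'e::finite \<Rightarrow> 'v::finite set"
  assumes "\<nu> \<in> dual_feasible edge s" "x \<in> range_feasible edge w r"
  shows "s \<bullet> x \<le> r \<bullet> \<nu>"
proof -
  have "(\<Sum>e\<in>UNIV. \<nu> $ e * edge_range edge e x) \<le> (\<Sum>e\<in>UNIV. \<nu> $ e * r $ e)"
    using assms dual_feasible_nonneg[OF assms(1)]
    by (intro sum_mono mult_left_mono) (auto simp: range_feasible_def)
  also have "\<dots> = r \<bullet> \<nu>"
    by (simp add: inner_vec_def mult.commute)
  finally show ?thesis
    using weak_duality[OF assms(1)] by (rule order_trans[rotated])
qed

lemma in_centered_space_iff:
  "x \<in> centered_space edge w \<longleftrightarrow> (\<Sum>v\<in>UNIV. degree edge w v * x $ v) = 0"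
proof -
  have "(degree_matrix edge w *v x) $ v = degree edge w v * x $ v" for v
    by (simp add: matrix_vector_mult_def degree_matrix_def if_distrib[of "\<lambda>a. a * _"] cong: if_cong)
  then show ?thesis
    by (simp add: centered_space_def inner_vec_def)
qed

text \<open>Subtracting the degree-weighted mean centers \<open>x\<close>. Such a shift preserves
  coordinate differences, and also \<open>s \<bullet> x\<close> when \<open>s\<close> sums to zero,
  so centering can be imposed at the end of strong duality.\<close>

lemma exists_shift_centered:
  fixes edge :: "'e::finite \<Rightarrow> 'v::finite set"
  assumes "weighted_hypergraph edge w"
  shows "\<exists>c. x - c *\<^sub>R 1 \<in> centered_space edge w"
proof -
  have w: "\<And>e. w $ e > 0" and ne: "\<And>e. edge e \<noteq> {}"
    using assms by (auto simp: weighted_hypergraph_def)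
  obtain e :: 'e and v where v: "v \<in> edge e"
    using ne by blast
  have deg_nonneg: "0 \<le> degree edge w u" for u
    unfolding degree_def using w by (intro sum_nonneg less_imp_le)
  have "0 < degree edge w v"
    unfolding degree_def using v w by (intro sum_pos) auto
  define S where "S = (\<Sum>u\<in>UNIV. degree edge w u)"
  have "0 < S"
    unfolding S_def using deg_nonneg \<open>0 < degree edge w v\<close> by (intro sum_pos2[of UNIV v]) auto
  define c where "c = (\<Sum>u\<in>UNIV. degree edge w u * x $ u) / S"
  have "(\<Sum>u\<in>UNIV. degree edge w u * (x - c *\<^sub>R 1) $ u)
      = (\<Sum>u\<in>UNIV. degree edge w u * x $ u) - S * c"
    by (simp add: S_def right_diff_distrib sum_subtractf sum_distrib_right)
  also have "\<dots> = 0"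
    using \<open>0 < S\<close> by (simp add: c_def)
  finally show ?thesis
    unfolding in_centered_space_iff ..
qed

text \<open>
  Farkas' lemma: the primal system \<open>x\<^sub>u - x\<^sub>v \<le> r\<^sub>e\<close>, \<open>\<langle>s, x\<rangle> \<ge> \<langle>r, \<nu>\<rangle>\<close> is solvable
  because \<open>(0, -1)\<close> lies outside the finitely generated cone of its consequences.
\<close>

lemma strong_duality:
  fixes edge :: "'e::finite \<Rightarrow> 'v::finite set"
  assumes H: "weighted_hypergraph edge w" and s: "1 \<bullet> s = 0" and r: "\<And>e. 0 \<le> r $ e"
    and \<nu>: "\<nu> \<in> dual_feasible edge s"
    and min: "\<And>\<nu>'. \<nu>' \<in> dual_feasible edge s \<Longrightarrow> r \<bullet> \<nu> \<le> r \<bullet> \<nu>'"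
  obtains x where "x \<in> range_feasible edge w r" "s \<bullet> x = r \<bullet> \<nu>"
proof -
  \<comment> \<open>Each generator encodes an inequality as a pair of coefficients and bound. A
    functional \<open>(y, t)\<close> with \<open>t > 0\<close> that is nonnegative on
    \<open>G\<close> yields the solution \<open>- y / t\<close>; the pair \<open>(0, 1)\<close>
    stands for the trivial inequality \<open>0 \<le> 1\<close>.\<close>
  define G where "G = insert (- s, - (r \<bullet> \<nu>)) (insert (0, 1)
    ((\<lambda>(e, u, v). (axis u 1 - axis v 1, r $ e)) ` {(e, u, v). u \<in> edge e \<and> v \<in> edge e}))"
  \<comment> \<open>An explicit convex cone containing \<open>G\<close>: \<open>\<eta>\<close>
    collects the multipliers of the range constraints, \<open>k\<close> is the multiplier of the
    objective constraint, and the inequality leaves room for multiples of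
    \<open>(0, 1)\<close>.\<close>
  define C where "C = {(a - k *\<^sub>R s, b) |a k b. 0 \<le> k \<and>
    (\<exists>\<eta>\<in>dual_feasible edge a. r \<bullet> \<eta> - k * (r \<bullet> \<nu>) \<le> b)}"
  have CI: "(a - k *\<^sub>R s, b) \<in> C"
    if "0 \<le> k" "\<eta> \<in> dual_feasible edge a" "r \<bullet> \<eta> - k * (r \<bullet> \<nu>) \<le> b" for a k b \<eta>
    using that unfolding C_def by blast
  have "convex_cone C"
    unfolding convex_cone_iff
  proof (intro conjI ballI allI impI)
    show "0 \<in> C"
      using CI[of 0 0 0 0] by (simp add: dual_feasible_zero zero_prod_def)
  next
    fix y z assume "y \<in> C" "z \<in> C"
    then obtain a k b \<eta> a' k' b' \<eta>' where
      *: "y = (a - k *\<^sub>R s, b)" "0 \<le> k" "\<eta> \<in> dual_feasible edge a" "r \<bullet> \<eta> - k * (r \<bullet> \<nu>) \<le> b"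
        "z = (a' - k' *\<^sub>R s, b')" "0 \<le> k'" "\<eta>' \<in> dual_feasible edge a'" "r \<bullet> \<eta>' - k' * (r \<bullet> \<nu>) \<le> b'"
      unfolding C_def by blast
    then show "y + z \<in> C"
      using CI[of "k + k'" "\<eta> + \<eta>'" "a + a'" "b + b'"] dual_feasible_add[OF *(3,7)]
      by (simp add: algebra_simps inner_add_right)
  next
    fix y and c :: real assume "y \<in> C" "0 \<le> c"
    then obtain a k b \<eta> where
      *: "y = (a - k *\<^sub>R s, b)" "0 \<le> k" "\<eta> \<in> dual_feasible edge a" "r \<bullet> \<eta> - k * (r \<bullet> \<nu>) \<le> b"
      unfolding C_def by blast
    have "c * (r \<bullet> \<eta> - k * (r \<bullet> \<nu>)) \<le> c * b"
      using * \<open>0 \<le> c\<close> by (intro mult_left_mono)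
    then show "c *\<^sub>R y \<in> C"
      using CI[of "c * k" "c *\<^sub>R \<eta>" "c *\<^sub>R a" "c * b"] dual_feasible_scaleR[OF *(3) \<open>0 \<le> c\<close>] * \<open>0 \<le> c\<close>
      by (simp add: algebra_simps)
  qed
  moreover have "G \<subseteq> C"
  proof -
    have "(- s, - (r \<bullet> \<nu>)) \<in> C" "(0, 1) \<in> C"
      using CI[of 1 0 0 "- (r \<bullet> \<nu>)"] CI[of 0 0 0 1] by (simp_all add: dual_feasible_zero)
    moreover have "(axis u 1 - axis v 1, r $ e) \<in> C" if "u \<in> edge e" "v \<in> edge e" for e u v
      using CI[of 0 "axis e 1" "axis u 1 - axis v 1" "r $ e"] dual_feasible_axis[of u edge e v] that
      by (simp add: inner_axis)
    ultimately show ?thesis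
      unfolding G_def by auto
  qed
  ultimately have hull_sub: "convex_cone hull G \<subseteq> C"
    by (simp add: hull_minimal)
  have "(0, -1) \<notin> C"
  proof
    assume "(0, -1) \<in> C"
    then obtain a k \<eta> where *: "a = k *\<^sub>R s" "0 \<le> k" "\<eta> \<in> dual_feasible edge a"
      "r \<bullet> \<eta> - k * (r \<bullet> \<nu>) \<le> -1"
      unfolding C_def by auto
    \<comment> \<open>For \<open>k = 0\<close> the cost of \<open>\<eta>\<close> would be negative;
      for \<open>k > 0\<close> the vector \<open>\<eta> / k\<close> would be feasible for
      \<open>s\<close> and cheaper than \<open>\<nu>\<close>.\<close>
    show False
    proof (cases "k = 0")
      case True
      have "0 \<le> r \<bullet> \<eta>"
        unfolding inner_vec_def using r dual_feasible_nonneg[OF *(3)] by (auto intro: sum_nonneg)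
      with True *(4) show False by simp
    next
      case False
      then have "(1 / k) *\<^sub>R \<eta> \<in> dual_feasible edge s"
        using dual_feasible_scaleR[OF *(3), of "1 / k"] *(1,2) by simp
      then have "r \<bullet> \<nu> \<le> (r \<bullet> \<eta>) / k"
        using min by fastforce
      then have "k * (r \<bullet> \<nu>) \<le> r \<bullet> \<eta>"
        using False *(2) by (simp add: field_simps)
      with *(4) show False by simp
    qed
  qed
  with hull_sub have "(0, -1) \<notin> convex_cone hull G"
    by blast
  \<comment> \<open>Finiteness of \<open>G\<close> makes the hull closed, as strict separation
    requires.\<close>
  moreover have "closed (convex_cone hull G)"
    by (intro closed_convex_cone_hull) (simp add: G_def)
  ultimately obtain z d where z: "z \<bullet> (0, -1) < d" "\<And>g. g \<in> convex_cone hull G \<Longrightarrow> d < z \<bullet> g"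
    using separating_hyperplane_closed_point[OF convex_convex_cone_hull] by blast
  have "d < 0"
    using z(2)[OF convex_cone_hull_contains_0] by simp
  have nonneg: "0 \<le> z \<bullet> g" if "g \<in> G" for g
  proof (rule ccontr)
    assume neg: "\<not> 0 \<le> z \<bullet> g"
    \<comment> \<open>The factor is chosen so that \<open>z\<close> takes exactly the value
      \<open>d\<close> at this point of the hull, against strict separation.\<close>
    have "(d / (z \<bullet> g)) *\<^sub>R g \<in> convex_cone hull G"
      using that neg \<open>d < 0\<close> by (intro convex_cone_hull_mul hull_inc) (auto intro: divide_nonpos_nonpos)
    then show False
      using z(2) neg by fastforce
  qed
  obtain y t where zyt: "z = (y, t)"
    by fastforce
  have t: "0 < t"
    using z(1) \<open>d < 0\<close> by (simp add: zyt)
  define x0 where "x0 = - (1 / t) *\<^sub>R y"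
  obtain c where c: "x0 - c *\<^sub>R 1 \<in> centered_space edge w"
    using exists_shift_centered[OF H] by blast
  define x where "x = x0 - c *\<^sub>R 1"
  have "x $ u - x $ v \<le> r $ e" if "u \<in> edge e" "v \<in> edge e" for e u v
  proof -
    have "0 \<le> z \<bullet> (axis u 1 - axis v 1, r $ e)"
      using that by (intro nonneg) (force simp: G_def)
    then show ?thesis
      using t by (simp add: zyt x_def x0_def inner_diff_right inner_axis field_simps)
  qed
  then have feas: "x \<in> range_feasible edge w r"
    using c H by (simp add: range_feasible_def edge_range_le_iff weighted_hypergraph_def x_def)
  have "0 \<le> z \<bullet> (- s, - (r \<bullet> \<nu>))"
    by (intro nonneg) (simp add: G_def)
  then have "r \<bullet> \<nu> \<le> s \<bullet> x0"
    using t by (simp add: zyt x0_def field_simps inner_commute)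
  also have "\<dots> = s \<bullet> x"
    using s by (simp add: x_def inner_diff_right inner_commute)
  finally show ?thesis
    using that feas weak_duality_range_feasible[OF \<nu> feas] by force
qed

section \<open>Comparing the primal and dual objectives\<close>

text \<open>Weak duality followed, in each hyperedge, by Young's inequality, obtained from the
  square of \<open>w $ e * R - \<nu> $ e\<close>.\<close>

lemma primal_obj_ge:
  fixes edge :: "'e::finite \<Rightarrow> 'v::finite set"
  assumes w: "\<And>e. w $ e > 0" and "\<nu> \<in> dual_feasible edge s"
  shows "- dual_obj w \<nu> \<le> primal_obj edge w s x"
proof -
  have "\<nu> $ e * R \<le> 1 / 2 * (w $ e * R\<^sup>2) + 1 / 2 * (\<nu> $ e / w $ e * \<nu> $ e)" for e R
  proof -
    have "0 \<le> (w $ e * R - \<nu> $ e)\<^sup>2 / (2 * w $ e)"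
      using w[of e] by simp
    also have "\<dots> = 1 / 2 * (w $ e * R\<^sup>2) + 1 / 2 * (\<nu> $ e / w $ e * \<nu> $ e) - \<nu> $ e * R"
      using w[of e] by (simp add: field_simps power2_eq_square)
    finally show ?thesis by simp
  qed
  then have "(\<Sum>e\<in>UNIV. \<nu> $ e * edge_range edge e x)
      \<le> (\<Sum>e\<in>UNIV. 1 / 2 * (w $ e * (edge_range edge e x)\<^sup>2) + 1 / 2 * (\<nu> $ e / w $ e * \<nu> $ e))"
    by (intro sum_mono)
  also have "\<dots> = 1 / 2 * (\<Sum>e\<in>UNIV. w $ e * (edge_range edge e x)\<^sup>2) + dual_obj w \<nu>"
    unfolding sum.distrib sum_distrib_left[symmetric]
    using two_dual_obj_eq[of w \<nu>] w by (simp add: inner_vec_def)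
  finally show ?thesis
    using weak_duality[OF assms(2), of x] by (simp add: primal_obj_def)
qed

text \<open>The bound \<open>\<nu> $ e / w $ e\<close> is the range at which Young's inequality is
  tight; under it the quadratic term is at most \<open>dual_obj w \<nu>\<close>.\<close>

lemma primal_obj_le:
  fixes edge :: "'e::finite \<Rightarrow> 'v::finite set"
  assumes H: "weighted_hypergraph edge w" and x: "x \<in> range_feasible edge w (\<chi> e. \<nu> $ e / w $ e)"
  shows "primal_obj edge w s x \<le> dual_obj w \<nu> - s \<bullet> x"
proof -
  have w: "\<And>e. w $ e > 0"
    using H by (simp add: weighted_hypergraph_def)
  have "w $ e * (edge_range edge e x)\<^sup>2 \<le> \<nu> $ e / w $ e * \<nu> $ e" for e
  proof -
    have "(edge_range edge e x)\<^sup>2 \<le> (\<nu> $ e / w $ e)\<^sup>2"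
      using x H by (intro power_mono edge_range_nonneg)
        (auto simp: range_feasible_def weighted_hypergraph_def)
    then have "w $ e * (edge_range edge e x)\<^sup>2 \<le> w $ e * (\<nu> $ e / w $ e)\<^sup>2"
      using w[of e] by (intro mult_left_mono) auto
    then show ?thesis
      using w[of e] by (simp add: power2_eq_square)
  qed
  then have "(\<Sum>e\<in>UNIV. w $ e * (edge_range edge e x)\<^sup>2) \<le> (\<Sum>e\<in>UNIV. \<nu> $ e / w $ e * \<nu> $ e)"
    by (intro sum_mono)
  then show ?thesis
    using two_dual_obj_eq[of w \<nu>] w by (simp add: primal_obj_def inner_vec_def)
qed

section \<open>The gap identity and the two error bounds\<close>

theorem lemma5p1:
  fixes edge :: "'e::finite \<Rightarrow> 'v::finite set"
    and w :: "real ^ 'e"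
    and s :: "real ^ 'v"
    and \<mu> \<mu>_star \<mu>_bar r :: "real ^ 'e"
    and \<delta> :: real
  assumes "weighted_hypergraph edge w"
    and "hypergraph_connected edge"
    and "1 \<bullet> s = 0"
    and "\<mu> \<in> dual_feasible edge s"
    and "r = (\<chi> e. \<mu> $ e / w $ e)"
    and "is_arg_min (dual_obj w) (\<lambda>\<nu>. \<nu> \<in> dual_feasible edge s) \<mu>_star"
    and "is_arg_min (\<lambda>\<nu>. \<Sum>e\<in>UNIV. r $ e * \<nu> $ e) (\<lambda>\<nu>. \<nu> \<in> dual_feasible edge s) \<mu>_bar"
    and "\<delta> = dual_obj w \<mu> - dual_obj w \<mu>_star"
  shows "0 \<le> 2 * dual_obj w \<mu> - range_value edge w s r
    \<and> 2 * dual_obj w \<mu> - range_value edge w s r = (\<Sum>e\<in>UNIV. r $ e * (\<mu> $ e - \<mu>_bar $ e))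
    \<and> (\<Sum>e\<in>UNIV. r $ e * (\<mu> $ e - \<mu>_bar $ e))
        \<le> \<delta> + sqrt (2 * \<delta>) * inv_weight_norm w (\<mu> - \<mu>_bar)
    \<and> (\<forall>x\<^sub>r. is_arg_max (\<lambda>x. s \<bullet> x) (\<lambda>x. x \<in> range_feasible edge w r) x\<^sub>r \<longrightarrow>
          primal_obj edge w s x\<^sub>r - primal_opt edge w s
            \<le> sqrt (2 * \<delta>) * inv_weight_norm w (\<mu> - \<mu>_bar))"
proof -
  note H = assms(1)
  have w: "\<And>e. w $ e > 0"
    using H by (simp add: weighted_hypergraph_def)
  have star: "\<mu>_star \<in> dual_feasible edge s"
    and star_min: "\<And>\<nu>. \<nu> \<in> dual_feasible edge s \<Longrightarrow> norm (rescale w \<mu>_star) \<le> norm (rescale w \<nu>)"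
    using assms(6) w by (force simp: is_arg_min_def dual_obj_eq not_less)+
  have bar: "\<mu>_bar \<in> dual_feasible edge s"
    and bar_min: "\<And>\<nu>. \<nu> \<in> dual_feasible edge s \<Longrightarrow> r \<bullet> \<mu>_bar \<le> r \<bullet> \<nu>"
    using assms(7) by (auto simp: is_arg_min_def inner_vec_def not_less)
  have quot_nonneg: "0 \<le> (\<chi> e. \<nu> $ e / w $ e) $ e" if "\<nu> \<in> dual_feasible edge s" for \<nu> e
    using that w[of e] by (simp add: dual_feasible_nonneg)

  have r: "0 \<le> r $ e" for e
    using quot_nonneg[OF assms(4)] by (simp add: assms(5))
  obtain x where x: "x \<in> range_feasible edge w r" "s \<bullet> x = r \<bullet> \<mu>_bar"
    using strong_duality[OF H assms(3) r bar bar_min] by blast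
  \<comment> \<open>The point \<open>x\<close> attains the upper bound from weak duality, so
    \<open>GREATEST\<close> denotes a true maximum.\<close>
  have value_eq: "range_value edge w s r = r \<bullet> \<mu>_bar"
    unfolding range_value_def using x weak_duality_range_feasible[OF bar]
    by (intro Greatest_equality) force+
  have gap: "2 * dual_obj w \<mu> - range_value edge w s r = r \<bullet> (\<mu> - \<mu>_bar)"
    using two_dual_obj_eq[of w \<mu>, OF w, folded assms(5)] by (simp only: value_eq inner_diff_right)

  have convex: "convex (rescale w ` dual_feasible edge s)"
    using convex_linear_image[OF linear_rescale convex_dual_feasible] .
  have "rescale w \<mu> \<bullet> (rescale w \<mu> - rescale w \<mu>_bar)
      \<le> \<delta> + sqrt (2 * \<delta>) * norm (rescale w \<mu> - rescale w \<mu>_bar)"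
    using star bar assms(4,8) star_min w
    by (intro min_norm_gap[OF convex, of "rescale w \<mu>_star"]) (auto simp: dual_obj_eq)
  then have gap_le: "r \<bullet> (\<mu> - \<mu>_bar) \<le> \<delta> + sqrt (2 * \<delta>) * inv_weight_norm w (\<mu> - \<mu>_bar)"
    using w by (simp add: inv_weight_norm_eq inner_rescale assms(5) flip: linear_diff[OF linear_rescale])

  \<comment> \<open>The gradient of \<open>dual_obj w\<close> at \<open>\<mu>_star\<close>. By the
    variational inequality \<open>\<mu>_star\<close> also minimises this linear cost, so strong
    duality applies to it.\<close>
  define r' where "r' = (\<chi> e. \<mu>_star $ e / w $ e)"
  have "r' \<bullet> \<mu>_star \<le> r' \<bullet> \<nu>" if "\<nu> \<in> dual_feasible edge s" for \<nu>
    using min_norm_inner_ge[OF convex, of "rescale w \<mu>_star" "rescale w \<nu>"] star that star_min w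
    by (auto simp: inner_rescale r'_def)
  then obtain x' where x': "x' \<in> range_feasible edge w r'" "s \<bullet> x' = r' \<bullet> \<mu>_star"
    using strong_duality[OF H assms(3) _ star, of r'] quot_nonneg[OF star] unfolding r'_def by blast
  have "primal_obj edge w s x' \<le> - dual_obj w \<mu>_star"
    using primal_obj_le[OF H, of x' \<mu>_star s] x' two_dual_obj_eq[of w \<mu>_star] w by (simp add: r'_def)
  then have "primal_obj edge w s x' = - dual_obj w \<mu>_star"
    using primal_obj_ge[OF w star, of x'] by simp
  moreover have "x' \<in> centered_space edge w"
    using x' by (simp add: range_feasible_def)
  \<comment> \<open>As \<open>x'\<close> attains the lower bound of \<open>primal_obj_ge\<close>,
    \<open>LEAST\<close> denotes a true minimum.\<close>
  ultimately have opt: "primal_opt edge w s = - dual_obj w \<mu>_star"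
    unfolding primal_opt_def using primal_obj_ge[OF w star]
    by (intro Least_equality) (force, blast)

  have "primal_obj edge w s x\<^sub>r - primal_opt edge w s
      \<le> sqrt (2 * \<delta>) * inv_weight_norm w (\<mu> - \<mu>_bar)"
    if "is_arg_max (\<lambda>x. s \<bullet> x) (\<lambda>x. x \<in> range_feasible edge w r) x\<^sub>r" for x\<^sub>r
  proof -
    \<comment> \<open>Comparison with the \<open>x\<close> from strong duality shows that
      \<open>x\<^sub>r\<close> reaches the optimal value.\<close>
    have "x\<^sub>r \<in> range_feasible edge w r" "r \<bullet> \<mu>_bar \<le> s \<bullet> x\<^sub>r"
      using that x by (auto simp: is_arg_max_def not_less)
    then have "primal_obj edge w s x\<^sub>r \<le> dual_obj w \<mu> - range_value edge w s r"
      using primal_obj_le[OF H, of x\<^sub>r \<mu> s, folded assms(5)] value_eq by fastforce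
    then show ?thesis
      using gap gap_le opt assms(8) by simp
  qed
  moreover have "0 \<le> r \<bullet> (\<mu> - \<mu>_bar)"
    using bar_min[OF assms(4)] by (simp add: inner_diff_right)
  moreover have "r \<bullet> (\<mu> - \<mu>_bar) = (\<Sum>e\<in>UNIV. r $ e * (\<mu> $ e - \<mu>_bar $ e))"
    by (simp add: inner_vec_def)
  ultimately show ?thesis
    using gap gap_le by auto
qed

end
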